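(* Let $\mathcal{O}_2$ be the Cuntz algebra with generating isometries $\psi_1,\psi_2$, let $\mathcal{A}_C=\mathcal{O}_2^{U(1)}\subset\mathcal{O}_2$ be the CAR-subalgebra corresponding to the standard recursive fermion system, let $\delta\colon\mathcal{A}_C\to\mathcal{A}_C$ be the $*$-endomorphism $\delta(a)=\psi_1a\psi_1^*$, and let $\mathcal{A}_C\times_{\delta}\mathbb{Z}=\mathcal{B}(\mathcal{A}_C,\psi_1)$ be the crossed product of $\mathcal{A}_C$ by $\delta$, i.e. the $C^*$-subalgebra of $\mathcal{O}_2$ generated by $\mathcal{A}_C$ and $\psi_1$. Then $\mathcal{A}_C\times_{\delta}\mathbb{Z}$ is the Cuntz algebra: $\mathcal{A}_C\times_{\delta}\mathbb{Z}=\mathcal{O}_2$.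
   Context: The Cuntz algebra $\mathcal{O}_2$ is the unital $C^*$-algebra generated by isometries $\psi_1,\psi_2$ with $\psi_i^*\psi_j=\delta_{i,j}I$ and $\psi_1\psi_1^*+\psi_2\psi_2^*=I$. Standard recursive fermion system: put $\mathbf a=\psi_1\psi_2^*$ and $\zeta(X)=\psi_1X\psi_1^*-\psi_2X\psi_2^*$ for $X\in\mathcal{O}_2$. The elements $\zeta^{n-1}(\mathbf a)$, $n\ge1$, satisfy the canonical anticommutation relations, and $\mathcal{A}_C$ is the $C^*$-subalgebra of $\mathcal{O}_2$ they generate, i.e. the image of the CAR algebra under the embedding $a_n\mapsto\zeta^{n-1}(\mathbf a)$. It is a known fact (Kawamura) that $\mathcal{A}_C=\mathcal{O}_2^{U(1)}$, the fixed-point algebra of the action $\tau$ of $U(1)$ with $\tau(z)(\psi_i)=z\psi_i$; equivalently, $\mathcal{A}_C$ is the $C^*$-subalgebra of $\mathcal{O}_2$ generated by the monomials $\psi_{i_1}\cdots\psi_{i_k}\psi_{j_k}^*\cdots\psi_{j_1}^*$ with $i_1,\dots,i_k,j_1,\dots,j_k\in\{1,2\}$. Crossed product: $\mathcal{B}=\mathcal{B}(\mathcal{A}_C,\psi_1)$ is the $C^*$-algebra generated by $\mathcal{A}_C$ and the isometry $\psi_1$ (inside $\mathcal{O}_2$). It is regarded as the crossed product $\mathcal{A}_C\times_\delta\mathbb{Z}$ because $\psi_1a=\delta(a)\psi_1$ for all $a\in\mathcal{A}_C$, and because for every finite sum $x=\psi_1^{*N}a_{\overline N}+\dots+\psi_1^*a_{\overline1}+a_0+a_1\psi_1+\dots+a_N\psi_1^N$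 with coefficients in $\mathcal{A}_C$ one has $\|a_0\|\le\|x\|$; such sums form a dense $*$-subalgebra of $\mathcal{B}$. *)

theory Defs
  imports "HOL-Analysis.Analysis"
begin

section \<open>Unital C*-algebras\<close>

class cstar_algebra = real_normed_algebra_1 + banach +
  fixes scaleC :: "complex \<Rightarrow> 'a \<Rightarrow> 'a" (infixr \<open>*\<^sub>C\<close> 75)
    and star :: "'a \<Rightarrow> 'a"
  assumes scaleC_add_right: "c *\<^sub>C (x + y) = c *\<^sub>C x + c *\<^sub>C y"
    and scaleC_add_left: "(c + d) *\<^sub>C x = c *\<^sub>C x + d *\<^sub>C x"
    and scaleC_scaleC: "c *\<^sub>C (d *\<^sub>C x) = (c * d) *\<^sub>C x"
    and scaleR_scaleC: "r *\<^sub>R x = complex_of_real r *\<^sub>C x"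
    and mult_scaleC_left: "(c *\<^sub>C x) * y = c *\<^sub>C (x * y)"
    and mult_scaleC_right: "x * (c *\<^sub>C y) = c *\<^sub>C (x * y)"
    and norm_scaleC: "norm (c *\<^sub>C x) = cmod c * norm x"
    and star_add: "star (x + y) = star x + star y"
    and star_scaleC: "star (c *\<^sub>C x) = cnj c *\<^sub>C star x"
    and star_mult: "star (x * y) = star y * star x"
    and star_star [simp]: "star (star x) = x"
    and cstar_identity: "norm (star x * x) = (norm x)\<^sup>2"

definition star_subalgebra :: "'a::cstar_algebra set \<Rightarrow> bool" where
  "star_subalgebra B \<longleftrightarrow>
     0 \<in> B \<and>
     (\<forall>x\<in>B. \<forall>y\<in>B. x + y \<in> B) \<and>
     (\<forall>c. \<forall>x\<in>B. c *\<^sub>C x \<in> B) \<and>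
     (\<forall>x\<in>B. \<forall>y\<in>B. x * y \<in> B) \<and>
     (\<forall>x\<in>B. star x \<in> B)"

definition cstar_subalgebra :: "'a::cstar_algebra set \<Rightarrow> bool" where
  "cstar_subalgebra B \<longleftrightarrow> star_subalgebra B \<and> closed B"

definition cstar_gen :: "'a::cstar_algebra set \<Rightarrow> 'a set" where
  "cstar_gen S = cstar_subalgebra hull S"

definition star_hom_on :: "'a::cstar_algebra set \<Rightarrow> 'a set \<Rightarrow> ('a \<Rightarrow> 'a) \<Rightarrow> bool" where
  "star_hom_on A B f \<longleftrightarrow>
     (\<forall>x\<in>A. f x \<in> B) \<and>
     (\<forall>x\<in>A. \<forall>y\<in>A. f (x + y) = f x + f y) \<and>
     (\<forall>c. \<forall>x\<in>A. f (c *\<^sub>C x) = c *\<^sub>C f x) \<and>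
     (\<forall>x\<in>A. \<forall>y\<in>A. f (x * y) = f x * f y) \<and>
     (\<forall>x\<in>A. f (star x) = star (f x))"


section \<open>The Cuntz algebra, the CAR-subalgebra and the crossed product\<close>

definition cuntz_isometries :: "'a::cstar_algebra \<Rightarrow> 'a \<Rightarrow> bool" where
  "cuntz_isometries \<psi>1 \<psi>2 \<longleftrightarrow>
     star \<psi>1 * \<psi>1 = 1 \<and> star \<psi>2 * \<psi>2 = 1 \<and>
     star \<psi>1 * \<psi>2 = 0 \<and> star \<psi>2 * \<psi>1 = 0 \<and>
     \<psi>1 * star \<psi>1 + \<psi>2 * star \<psi>2 = 1"

text \<open>
  \<open>cuntz_algebra \<psi>1 \<psi>2\<close> is meant for \<open>cuntz_isometries \<psi>1 \<psi>2\<close>. It contains the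
  unit because of the relation \<open>star \<psi>1 * \<psi>1 = 1\<close>.
\<close>

definition cuntz_algebra :: "'a::cstar_algebra \<Rightarrow> 'a \<Rightarrow> 'a set" where
  "cuntz_algebra \<psi>1 \<psi>2 = cstar_gen {\<psi>1, \<psi>2}"

definition rfs_seed :: "'a::cstar_algebra \<Rightarrow> 'a \<Rightarrow> 'a" where
  "rfs_seed \<psi>1 \<psi>2 = \<psi>1 * star \<psi>2"

definition rfs_zeta :: "'a::cstar_algebra \<Rightarrow> 'a \<Rightarrow> 'a \<Rightarrow> 'a" where
  "rfs_zeta \<psi>1 \<psi>2 X = \<psi>1 * X * star \<psi>1 - \<psi>2 * X * star \<psi>2"

definition car_generator :: "'a::cstar_algebra \<Rightarrow> 'a \<Rightarrow> nat \<Rightarrow> 'a" where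
  "car_generator \<psi>1 \<psi>2 n = (rfs_zeta \<psi>1 \<psi>2 ^^ (n - 1)) (rfs_seed \<psi>1 \<psi>2)"

text \<open>
  The index starts at 1, so that \<open>car_generator \<psi>1 \<psi>2 n\<close> is the image of \<open>a\<^sub>n\<close>.
  Kawamura's identification of \<open>car_subalgebra \<psi>1 \<psi>2\<close> with the fixed-point algebra of
  the gauge action is \<open>car_subalgebra_eq_gauge_fixed\<close> below.
\<close>

definition car_subalgebra :: "'a::cstar_algebra \<Rightarrow> 'a \<Rightarrow> 'a set" where
  "car_subalgebra \<psi>1 \<psi>2 = cstar_gen {car_generator \<psi>1 \<psi>2 n |n. n \<ge> 1}"

definition delta :: "'a::cstar_algebra \<Rightarrow> 'a \<Rightarrow> 'a" where
  "delta \<psi>1 a = \<psi>1 * a * star \<psi>1"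

text \<open>
  \<open>crossed_product A V\<close> is \<open>\<B>(A, V)\<close>: the crossed product of \<open>A\<close> by the endomorphism
  \<open>a \<mapsto> V * a * star V\<close> that the isometry \<open>V\<close> implements on \<open>A\<close>. For \<open>A = \<A>\<^sub>C\<close> and
  \<open>V = \<psi>1\<close> the properties that make it a crossed product are
  \<open>delta_endomorphism\<close>, \<open>delta_covariance\<close> and \<open>crossed_product_coefficient_bound\<close> below.
\<close>

definition crossed_product :: "'a::cstar_algebra set \<Rightarrow> 'a \<Rightarrow> 'a set" where
  "crossed_product A V = cstar_gen (insert V A)"

text \<open>
  The gauge action, on a given realisation of the Cuntz algebra. A *-homomorphism of
  C*-algebras is automatically norm-decreasing; this is included in the definition
  because the library has no such theorem. The group law of \<open>\<tau>\<close> follows from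
  the values on the generators.
\<close>

definition gauge_action :: "'a::cstar_algebra \<Rightarrow> 'a \<Rightarrow> (complex \<Rightarrow> 'a \<Rightarrow> 'a) \<Rightarrow> bool" where
  "gauge_action \<psi>1 \<psi>2 \<tau> \<longleftrightarrow>
     (\<forall>z. cmod z = 1 \<longrightarrow>
        star_hom_on (cuntz_algebra \<psi>1 \<psi>2) (cuntz_algebra \<psi>1 \<psi>2) (\<tau> z) \<and>
        (\<forall>x\<in>cuntz_algebra \<psi>1 \<psi>2. norm (\<tau> z x) \<le> norm x) \<and>
        \<tau> z \<psi>1 = z *\<^sub>C \<psi>1 \<and> \<tau> z \<psi>2 = z *\<^sub>C \<psi>2)"

definition gauge_fixed :: "'a::cstar_algebra \<Rightarrow> 'a \<Rightarrow> (complex \<Rightarrow> 'a \<Rightarrow> 'a) \<Rightarrow> 'a set" where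
  "gauge_fixed \<psi>1 \<psi>2 \<tau> = {x \<in> cuntz_algebra \<psi>1 \<psi>2. \<forall>z. cmod z = 1 \<longrightarrow> \<tau> z x = x}"


section \<open>Background facts\<close>

lemma scaleC_one [simp]: "1 *\<^sub>C (x::'a::cstar_algebra) = x"
  using scaleR_scaleC[of 1 x] by simp

lemma scaleC_zero_left [simp]: "0 *\<^sub>C (x::'a::cstar_algebra) = 0"
  using scaleR_scaleC[of 0 x] by simp

lemma scaleC_zero_right [simp]: "c *\<^sub>C (0::'a::cstar_algebra) = 0"
  using scaleC_add_right[of c "0::'a" 0] by simp

lemma scaleC_minus1: "(-1) *\<^sub>C (x::'a::cstar_algebra) = - x"
  using scaleR_scaleC[of "-1" x] by simp

lemma scaleC_sum_left: "(\<Sum>i\<in>A. f i) *\<^sub>C (x::'a::cstar_algebra) = (\<Sum>i\<in>A. f i *\<^sub>C x)"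
  by (induction A rule: infinite_finite_induct) (simp_all add: scaleC_add_left)

lemma star_zero [simp]: "star (0::'a::cstar_algebra) = 0"
  using star_add[of "0::'a" 0] by simp

lemma star_one [simp]: "star (1::'a::cstar_algebra) = 1"
  by (metis mult.left_neutral mult.right_neutral star_mult star_star)

lemma star_minus [simp]: "star (- x::'a::cstar_algebra) = - star x"
  using star_scaleC[of "-1" x] by (simp add: scaleC_minus1)

lemma star_diff: "star (x - y::'a::cstar_algebra) = star x - star y"
  using star_add[of x "- y"] by simp

lemma norm_star [simp]: "norm (star x) = norm (x::'a::cstar_algebra)"
proof -
  have le: "norm y \<le> norm (star y)" for y :: 'a
  proof (cases "y = 0")
    case False
    have "norm y * norm y \<le> norm (star y) * norm y"
      using cstar_identity[of y] norm_mult_ineq[of "star y" y] by (simp add: power2_eq_square)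
    then show ?thesis using False by simp
  qed simp
  show ?thesis using le[of x] le[of "star x"] by simp
qed

lemma bounded_linear_star: "bounded_linear (star :: 'a::cstar_algebra \<Rightarrow> 'a)"
  by (rule bounded_linear_intro[where K = 1])
    (simp_all add: star_add scaleR_scaleC star_scaleC)

lemma bounded_linear_scaleC: "bounded_linear ((*\<^sub>C) c :: 'a::cstar_algebra \<Rightarrow> 'a)"
  by (rule bounded_linear_intro[where K = "cmod c"])
    (simp_all add: scaleC_add_right scaleR_scaleC scaleC_scaleC norm_scaleC mult.commute)

lemmas tendsto_star = bounded_linear.tendsto[OF bounded_linear_star]
lemmas tendsto_scaleC = bounded_linear.tendsto[OF bounded_linear_scaleC]

lemma star_subalgebraD:
  assumes "star_subalgebra B"
  shows "0 \<in> B" "x \<in> B \<Longrightarrow> y \<in> B \<Longrightarrow> x + y \<in> B" "x \<in> B \<Longrightarrow> c *\<^sub>C x \<in> B"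
    "x \<in> B \<Longrightarrow> y \<in> B \<Longrightarrow> x * y \<in> B" "x \<in> B \<Longrightarrow> star x \<in> B"
    "x \<in> B \<Longrightarrow> y \<in> B \<Longrightarrow> x - y \<in> B"
proof -
  show "x \<in> B \<Longrightarrow> y \<in> B \<Longrightarrow> x - y \<in> B"
    using assms unfolding star_subalgebra_def
    by (metis scaleC_minus1 diff_conv_add_uminus)
qed (use assms in \<open>auto simp: star_subalgebra_def\<close>)

lemma star_subalgebra_closure:
  fixes B :: "'a::cstar_algebra set"
  assumes B: "star_subalgebra B"
  shows "star_subalgebra (closure B)"
  unfolding star_subalgebra_def
proof (intro conjI ballI allI)
  show "0 \<in> closure B" using star_subalgebraD(1)[OF B] closure_subset by blast
next
  fix x y assume "x \<in> closure B" "y \<in> closure B"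
  then obtain f g where *: "\<And>n. f n \<in> B" "f \<longlonglongrightarrow> x" "\<And>n. g n \<in> B" "g \<longlonglongrightarrow> y"
    by (auto simp: closure_sequential)
  show "x + y \<in> closure B"
    unfolding closure_sequential
    by (rule exI[of _ "\<lambda>n. f n + g n"]) (auto intro: * tendsto_add star_subalgebraD(2)[OF B])
  show "x * y \<in> closure B"
    unfolding closure_sequential
    by (rule exI[of _ "\<lambda>n. f n * g n"]) (auto intro: * tendsto_mult star_subalgebraD(4)[OF B])
next
  fix x c assume "x \<in> closure B"
  then obtain f where *: "\<And>n. f n \<in> B" "f \<longlonglongrightarrow> x"
    by (auto simp: closure_sequential)
  show "c *\<^sub>C x \<in> closure B"
    unfolding closure_sequential
    by (rule exI[of _ "\<lambda>n. c *\<^sub>C f n"]) (auto intro: * tendsto_scaleC star_subalgebraD(3)[OF B])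
next
  fix x assume "x \<in> closure B"
  then obtain f where *: "\<And>n. f n \<in> B" "f \<longlonglongrightarrow> x"
    by (auto simp: closure_sequential)
  show "star x \<in> closure B"
    unfolding closure_sequential
    by (rule exI[of _ "\<lambda>n. star (f n)"]) (auto intro: * tendsto_star star_subalgebraD(5)[OF B])
qed

lemma cstar_subalgebra_cstar_gen: "cstar_subalgebra (cstar_gen S)"
  unfolding cstar_gen_def
  by (rule hull_in) (auto simp: cstar_subalgebra_def star_subalgebra_def)

lemmas star_subalgebra_cstar_gen =
  cstar_subalgebra_cstar_gen[unfolded cstar_subalgebra_def, THEN conjunct1]
lemmas closed_cstar_gen =
  cstar_subalgebra_cstar_gen[unfolded cstar_subalgebra_def, THEN conjunct2]
lemmas cstar_genD = star_subalgebraD[OF star_subalgebra_cstar_gen]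

lemma cstar_gen_superset: "S \<subseteq> cstar_gen S"
  unfolding cstar_gen_def by (rule hull_subset)

lemma cstar_gen_subset_closure:
  assumes "star_subalgebra B" "S \<subseteq> B"
  shows "cstar_gen S \<subseteq> closure B"
  unfolding cstar_gen_def
proof (rule hull_minimal)
  show "S \<subseteq> closure B" using assms(2) closure_subset by blast
  show "cstar_subalgebra (closure B)"
    using star_subalgebra_closure[OF assms(1)] by (simp add: cstar_subalgebra_def)
qed

lemma cstar_gen_minimal:
  assumes "star_subalgebra B" "closed B" "S \<subseteq> B"
  shows "cstar_gen S \<subseteq> B"
  using cstar_gen_subset_closure[OF assms(1,3)] assms(2) by simp

lemma star_subalgebra_power:
  assumes "star_subalgebra B" "1 \<in> B" "x \<in> B"
  shows "x ^ n \<in> B"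
  using assms by (induction n) (auto intro: star_subalgebraD)

context
  fixes \<psi>1 \<psi>2 :: "'a::cstar_algebra"
  assumes cuntz: "cuntz_isometries \<psi>1 \<psi>2"
begin

lemma cuntz_relations:
  "star \<psi>1 * \<psi>1 = 1" "star \<psi>2 * \<psi>2 = 1" "star \<psi>1 * \<psi>2 = 0" "star \<psi>2 * \<psi>1 = 0"
  "\<psi>1 * star \<psi>1 + \<psi>2 * star \<psi>2 = 1"
  using cuntz unfolding cuntz_isometries_def by auto

lemma cuntz_cancel:
  "star \<psi>1 * (\<psi>1 * x) = x" "star \<psi>2 * (\<psi>2 * x) = x"
  "star \<psi>1 * (\<psi>2 * x) = 0" "star \<psi>2 * (\<psi>1 * x) = 0"
  by (simp_all add: cuntz_relations flip: mult.assoc)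

lemmas cuntz_simps = cuntz_relations(1-4) cuntz_cancel

lemma car_generator_Suc: "n \<ge> 1 \<Longrightarrow>
    car_generator \<psi>1 \<psi>2 (Suc n) = rfs_zeta \<psi>1 \<psi>2 (car_generator \<psi>1 \<psi>2 n)"
  by (cases n) (auto simp: car_generator_def)

lemma car_generator_in: "n \<ge> 1 \<Longrightarrow> car_generator \<psi>1 \<psi>2 n \<in> car_subalgebra \<psi>1 \<psi>2"
  unfolding car_subalgebra_def using cstar_gen_superset by fast

lemma star_subalgebra_car: "star_subalgebra (car_subalgebra \<psi>1 \<psi>2)"
  unfolding car_subalgebra_def by (rule star_subalgebra_cstar_gen)

lemma matrix_units_in_car:
  "\<psi>1 * star \<psi>2 \<in> car_subalgebra \<psi>1 \<psi>2" "\<psi>2 * star \<psi>1 \<in> car_subalgebra \<psi>1 \<psi>2"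
  "\<psi>1 * star \<psi>1 \<in> car_subalgebra \<psi>1 \<psi>2" "\<psi>2 * star \<psi>2 \<in> car_subalgebra \<psi>1 \<psi>2"
  "1 \<in> car_subalgebra \<psi>1 \<psi>2"
proof -
  note D = star_subalgebraD[OF star_subalgebra_car]
  show a: "\<psi>1 * star \<psi>2 \<in> car_subalgebra \<psi>1 \<psi>2"
    using car_generator_in[of 1] by (simp add: car_generator_def rfs_seed_def)
  show b: "\<psi>2 * star \<psi>1 \<in> car_subalgebra \<psi>1 \<psi>2"
    using D(5)[OF a] by (simp add: star_mult)
  show c: "\<psi>1 * star \<psi>1 \<in> car_subalgebra \<psi>1 \<psi>2"
    using D(4)[OF a b] by (simp add: mult.assoc cuntz_simps)
  show d: "\<psi>2 * star \<psi>2 \<in> car_subalgebra \<psi>1 \<psi>2"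
    using D(4)[OF b a] by (simp add: mult.assoc cuntz_simps)
  show "1 \<in> car_subalgebra \<psi>1 \<psi>2"
    using D(2)[OF c d] by (simp add: cuntz_relations)
qed

lemmas carD = star_subalgebraD[OF star_subalgebra_car]

lemma delta_car:
  assumes "x \<in> car_subalgebra \<psi>1 \<psi>2"
  shows "delta \<psi>1 x \<in> car_subalgebra \<psi>1 \<psi>2"
proof -
  let ?A = "car_subalgebra \<psi>1 \<psi>2"
  define B where "B = {x. \<psi>1 * x * star \<psi>1 \<in> ?A}"
  have "cstar_gen {car_generator \<psi>1 \<psi>2 n |n. n \<ge> 1} \<subseteq> B"
  proof (rule cstar_gen_minimal)
    show "star_subalgebra B"
      unfolding star_subalgebra_def B_def
    proof (safe, goal_cases)
      case 1 show ?case by (simp add: carD)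
    next
      case (2 x y) then show ?case using carD(2)[OF 2] by (simp add: algebra_simps)
    next
      case (3 c x) then show ?case
        using carD(3)[OF 3, of c] by (simp add: mult_scaleC_left mult_scaleC_right)
    next
      case (4 x y) then show ?case
        using carD(4)[OF 4] by (simp add: mult.assoc cuntz_simps)
    next
      case (5 x) then show ?case
        using carD(5)[OF 5] by (simp add: star_mult mult.assoc)
    qed
    have "closed ((\<lambda>x. \<psi>1 * x * star \<psi>1) -` ?A)"
      unfolding car_subalgebra_def
      by (intro closed_vimage closed_cstar_gen continuous_intros)
    then show "closed B" by (simp add: B_def vimage_def)
    show "{car_generator \<psi>1 \<psi>2 n |n. n \<ge> 1} \<subseteq> B"
    proof safe
      fix n :: nat assume n: "n \<ge> 1"
      have "car_generator \<psi>1 \<psi>2 (Suc n) * (\<psi>1 * star \<psi>1) \<in> ?A"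
        by (intro carD car_generator_in matrix_units_in_car) simp
      then show "car_generator \<psi>1 \<psi>2 n \<in> B"
        by (simp add: B_def car_generator_Suc[OF n] rfs_zeta_def algebra_simps cuntz_simps)
    qed
  qed
  then show ?thesis using assms by (auto simp: delta_def B_def car_subalgebra_def)
qed

theorem delta_endomorphism:
  "star_hom_on (car_subalgebra \<psi>1 \<psi>2) (car_subalgebra \<psi>1 \<psi>2) (delta \<psi>1)"
  unfolding star_hom_on_def
  by (auto simp: delta_car)
    (auto simp: delta_def algebra_simps mult_scaleC_left mult_scaleC_right star_mult cuntz_simps)

theorem delta_covariance: "\<psi>1 * a = delta \<psi>1 a * \<psi>1"
  by (simp add: delta_def mult.assoc cuntz_relations)


subsection \<open>The coefficient bound\<close>

definition can_endo :: "'a \<Rightarrow> 'a" where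
  "can_endo X = \<psi>1 * X * star \<psi>1 + \<psi>2 * X * star \<psi>2"

abbreviation "\<rho> m \<equiv> can_endo ^^ m"

lemma can_endo_hom: "can_endo (X * Y) = can_endo X * can_endo Y"
    "can_endo (star X) = star (can_endo X)" "can_endo 1 = 1" "can_endo 0 = 0"
  by (simp_all add: can_endo_def algebra_simps cuntz_simps cuntz_relations(5) star_add star_mult)

lemma rho_hom: "\<rho> m (X * Y) = \<rho> m X * \<rho> m Y" "\<rho> m (star X) = star (\<rho> m X)"
    "\<rho> m 1 = 1" "\<rho> m 0 = 0"
  by (induction m) (simp_all add: can_endo_hom)

lemma rho_psi1: "\<psi>1 ^ k * X = \<rho> k X * \<psi>1 ^ k"
proof (induction k)
  case (Suc k)
  have "\<psi>1 * Y = can_endo Y * \<psi>1" for Y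
    by (simp add: can_endo_def algebra_simps cuntz_simps)
  then show ?case using Suc by (simp add: mult.assoc) (metis mult.assoc)
qed simp

definition commutant :: "nat \<Rightarrow> 'a set" where
  "commutant m = {x. \<forall>X. x * \<rho> m X = \<rho> m X * x}"

lemma commutant_mono: "m \<le> n \<Longrightarrow> commutant m \<subseteq> commutant n"
  unfolding commutant_def by (auto simp: funpow_add dest!: le_Suc_ex)

lemma star_subalgebra_commutant: "star_subalgebra (\<Union>m. commutant m)"
proof -
  have common: "\<exists>k. x \<in> commutant k \<and> y \<in> commutant k"
    if "x \<in> commutant m" "y \<in> commutant n" for x y m n
    using that commutant_mono[of m "max m n"] commutant_mono[of n "max m n"] by auto
  have add: "x + y \<in> commutant k" and mult: "x * y \<in> commutant k"
    if "x \<in> commutant k" "y \<in> commutant k" for x y k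
    using that unfolding commutant_def
    by (simp_all add: algebra_simps) (metis mult.assoc)
  have star: "star x \<in> commutant k" if "x \<in> commutant k" for x k
    unfolding commutant_def
  proof safe
    fix X
    have "star (x * \<rho> k (star X)) = star (\<rho> k (star X) * x)"
      using that by (simp add: commutant_def)
    then show "star x * \<rho> k X = \<rho> k X * star x"
      by (simp add: star_mult rho_hom)
  qed
  have scale: "c *\<^sub>C x \<in> commutant k" if "x \<in> commutant k" for c x k
    using that by (simp add: commutant_def mult_scaleC_left mult_scaleC_right)
  have zero: "0 \<in> commutant 0" by (simp add: commutant_def)
  show ?thesis
    unfolding star_subalgebra_def
    using zero by (auto intro: star scale) (metis common add, metis common mult)
qed

lemma car_generator_commutant: "car_generator \<psi>1 \<psi>2 (Suc n) \<in> commutant (Suc n)"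
proof (induction n)
  case 0
  show ?case
    by (simp add: commutant_def car_generator_def rfs_seed_def can_endo_def algebra_simps cuntz_simps)
next
  case (Suc n)
  let ?x = "car_generator \<psi>1 \<psi>2 (Suc n)"
  have "rfs_zeta \<psi>1 \<psi>2 ?x * can_endo (\<rho> (Suc n) X)
      = can_endo (\<rho> (Suc n) X) * rfs_zeta \<psi>1 \<psi>2 ?x" for X
  proof -
    have c: "?x * \<rho> (Suc n) X = \<rho> (Suc n) X * ?x"
      using Suc by (simp add: commutant_def)
    define Y where "Y = \<rho> (Suc n) X"
    have c': "?x * (Y * Z) = Y * (?x * Z)" for Z
      using c by (metis Y_def mult.assoc)
    show ?thesis
      unfolding Y_def[symmetric]
      by (simp add: rfs_zeta_def can_endo_def algebra_simps cuntz_simps c')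
  qed
  then show ?case
    unfolding commutant_def by (simp add: car_generator_Suc)
qed

lemma car_dense_commutant: "car_subalgebra \<psi>1 \<psi>2 \<subseteq> closure (\<Union>m. commutant m)"
  unfolding car_subalgebra_def
proof (rule cstar_gen_subset_closure[OF star_subalgebra_commutant], safe)
  fix n :: nat assume "n \<ge> 1"
  then show "car_generator \<psi>1 \<psi>2 n \<in> (\<Union>m. commutant m)"
    using car_generator_commutant[of "n - 1"] by auto
qed

lemma isometry_power: "star (\<psi>1 ^ k) * \<psi>1 ^ k = 1"
proof (induction k)
  case (Suc k)
  have "star (\<psi>1 ^ Suc k) * \<psi>1 ^ Suc k = star (\<psi>1 ^ k) * (star \<psi>1 * \<psi>1) * \<psi>1 ^ k"
    by (simp add: star_mult mult.assoc)
  then show ?case using Suc by (simp add: cuntz_simps)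
qed simp

lemma coefficient_bound_commutant:
  assumes a: "\<And>k. k \<le> N \<Longrightarrow> a k \<in> commutant m" and b: "\<And>k. k \<le> N \<Longrightarrow> b k \<in> commutant m"
  shows "norm (a 0) \<le> norm ((\<Sum>k=1..N. star (\<psi>1 ^ k) * b k) + a 0 + (\<Sum>k=1..N. a k * \<psi>1 ^ k))"
    (is "_ \<le> norm ?x")
proof -
  define \<gamma> where "\<gamma> = \<psi>1 ^ N * \<psi>2"
  define w where "w = \<rho> m \<gamma>"
  have g1: "star \<gamma> * \<gamma> = 1"
  proof -
    have "star \<gamma> * \<gamma> = star \<psi>2 * (star (\<psi>1 ^ N) * \<psi>1 ^ N) * \<psi>2"
      by (simp add: \<gamma>_def star_mult mult.assoc)
    then show ?thesis by (simp add: isometry_power cuntz_simps)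
  qed
  have w1: "star w * w = 1"
  proof -
    have "star w * w = \<rho> m (star \<gamma> * \<gamma>)"
      by (simp only: w_def rho_hom)
    then show ?thesis by (simp only: g1 rho_hom)
  qed
  have nw: "norm w = 1"
  proof -
    have "(norm w)\<^sup>2 = 1" using cstar_identity[of w] w1 by simp
    then show ?thesis using power2_eq_1_iff[of "norm w"] norm_ge_zero[of w] by linarith
  qed
  have g0: "star \<gamma> * \<rho> k \<gamma> = 0" if k: "1 \<le> k" "k \<le> N" for k
  proof -
    have e: "star (\<psi>1 ^ k) * \<rho> k X = X * star (\<psi>1 ^ k)" for X
    proof -
      have "star (\<psi>1 ^ k * star X) = star (\<rho> k (star X) * \<psi>1 ^ k)"
        by (simp only: rho_psi1)
      then show ?thesis by (simp add: star_mult rho_hom)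
    qed
    have "\<psi>1 ^ N = \<psi>1 ^ k * \<psi>1 ^ (N - k)"
      using k by (metis le_add_diff_inverse power_add)
    then have "star \<gamma> * \<rho> k \<gamma> = star \<psi>2 * star (\<psi>1 ^ (N - k)) * (star (\<psi>1 ^ k) * \<rho> k \<gamma>)"
      by (simp add: \<gamma>_def star_mult mult.assoc)
    also have "\<dots> = star \<psi>2 * star (\<psi>1 ^ (N - k)) * \<gamma> * star (\<psi>1 ^ k)"
      by (simp only: e mult.assoc)
    also have "\<dots> = star \<psi>2 * (star (\<psi>1 ^ (N - k)) * \<psi>1 ^ (N - k)) * (\<psi>1 ^ k * \<psi>2) * star (\<psi>1 ^ k)"
    proof -
      have "\<gamma> = \<psi>1 ^ (N - k) * (\<psi>1 ^ k * \<psi>2)"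
        using k by (metis \<gamma>_def le_add_diff_inverse2 power_add mult.assoc)
      then show ?thesis by (simp only: mult.assoc)
    qed
    also have "\<dots> = star \<psi>2 * \<psi>1 ^ k * \<psi>2 * star (\<psi>1 ^ k)"
      by (simp add: isometry_power mult.assoc)
    also have "star \<psi>2 * \<psi>1 ^ k = 0"
      using k by (cases k) (simp_all add: cuntz_simps)
    finally show ?thesis by simp
  qed
  have z: "star w * \<psi>1 ^ k * w = 0" if k: "1 \<le> k" "k \<le> N" for k
  proof -
    have "star w * \<psi>1 ^ k * w = star w * \<rho> k w * \<psi>1 ^ k"
      by (simp add: mult.assoc rho_psi1)
    also have "\<rho> k w = \<rho> m (\<rho> k \<gamma>)"
      unfolding w_def by (metis add.commute comp_apply funpow_add)
    also have "star w * \<rho> m (\<rho> k \<gamma>) = \<rho> m (star \<gamma> * \<rho> k \<gamma>)"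
      by (simp add: w_def rho_hom)
    finally show ?thesis by (simp add: g0[OF k] rho_hom)
  qed
  have comm: "c * w = w * c" "star w * c = c * star w" if "c \<in> commutant m" for c
    using that by (auto simp: commutant_def w_def simp flip: rho_hom(2))
  have A: "star w * (a k * \<psi>1 ^ k) * w = 0" if "1 \<le> k" "k \<le> N" for k
  proof -
    have "star w * (a k * \<psi>1 ^ k) * w = a k * (star w * \<psi>1 ^ k * w)"
      using comm(2)[OF a[OF that(2)]] by (metis mult.assoc)
    then show ?thesis using z[OF that] by simp
  qed
  have B: "star w * (star (\<psi>1 ^ k) * b k) * w = 0" if "1 \<le> k" "k \<le> N" for k
  proof -
    have "star w * (star (\<psi>1 ^ k) * b k) * w = star (star w * \<psi>1 ^ k * w) * b k"
      using comm(1)[OF b[OF that(2)]] by (simp add: star_mult mult.assoc)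
    then show ?thesis using z[OF that] by simp
  qed
  have C: "star w * a 0 * w = a 0"
    using comm(2)[OF a[of 0]] w1 by (simp add: mult.assoc)
  have "star w * ?x * w = a 0"
    by (simp add: distrib_left distrib_right sum_distrib_left sum_distrib_right A B C)
  then have "norm (a 0) \<le> norm (star w * ?x)"
    using norm_mult_ineq[of "star w * ?x" w] by (simp add: nw)
  also have "\<dots> \<le> norm ?x"
    using norm_mult_ineq[of "star w" ?x] by (simp add: nw)
  finally show ?thesis .
qed

theorem crossed_product_coefficient_bound:
  assumes a: "\<And>k. k \<le> N \<Longrightarrow> a k \<in> car_subalgebra \<psi>1 \<psi>2"
    and b: "\<And>k. k \<le> N \<Longrightarrow> b k \<in> car_subalgebra \<psi>1 \<psi>2"
  shows "norm (a 0) \<le> norm ((\<Sum>k=1..N. star \<psi>1 ^ k * b k) + a 0 + (\<Sum>k=1..N. a k * \<psi>1 ^ k))"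
proof -
  have "\<exists>f. (\<forall>n. f n \<in> (\<Union>m. commutant m)) \<and> f \<longlonglongrightarrow> x" if "x \<in> car_subalgebra \<psi>1 \<psi>2" for x
    using car_dense_commutant that by (auto simp: closure_sequential subset_iff)
  then have "\<forall>k. \<exists>f. k \<le> N \<longrightarrow> (\<forall>n. f n \<in> (\<Union>m. commutant m)) \<and> f \<longlonglongrightarrow> a k"
    "\<forall>k. \<exists>f. k \<le> N \<longrightarrow> (\<forall>n. f n \<in> (\<Union>m. commutant m)) \<and> f \<longlonglongrightarrow> b k"
    using a b by meson+
  then obtain f g where
    f: "\<And>k n. k \<le> N \<Longrightarrow> f k n \<in> (\<Union>m. commutant m)" "\<And>k. k \<le> N \<Longrightarrow> f k \<longlonglongrightarrow> a k" and
    g: "\<And>k n. k \<le> N \<Longrightarrow> g k n \<in> (\<Union>m. commutant m)" "\<And>k. k \<le> N \<Longrightarrow> g k \<longlonglongrightarrow> b k"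
    by metis
  have star_power: "star (\<psi>1 ^ k) = star \<psi>1 ^ k" for k
    by (induction k) (simp_all add: star_mult power_commutes)
  have "norm (f 0 n) \<le> norm ((\<Sum>k=1..N. star (\<psi>1 ^ k) * g k n) + f 0 n + (\<Sum>k=1..N. f k n * \<psi>1 ^ k))"
    for n
  proof -
    have "\<forall>k. \<exists>m. k \<le> N \<longrightarrow> f k n \<in> commutant m" "\<forall>k. \<exists>m. k \<le> N \<longrightarrow> g k n \<in> commutant m"
      using f(1) g(1) by blast+
    then obtain p q where p: "\<And>k. k \<le> N \<Longrightarrow> f k n \<in> commutant (p k)"
      and q: "\<And>k. k \<le> N \<Longrightarrow> g k n \<in> commutant (q k)" by metis
    define m where "m = Max (p ` {..N} \<union> q ` {..N})"
    have "p k \<le> m" "q k \<le> m" if "k \<le> N" for k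
      using that by (auto simp: m_def intro!: Max_ge)
    then show ?thesis
      using p q commutant_mono
      by (intro coefficient_bound_commutant[of N "\<lambda>k. f k n" m "\<lambda>k. g k n"]) blast+
  qed
  moreover have "(\<lambda>n. norm (f 0 n)) \<longlonglongrightarrow> norm (a 0)"
    by (intro tendsto_norm f) simp
  moreover have "(\<lambda>n. norm ((\<Sum>k=1..N. star (\<psi>1 ^ k) * g k n) + f 0 n + (\<Sum>k=1..N. f k n * \<psi>1 ^ k)))
     \<longlonglongrightarrow> norm ((\<Sum>k=1..N. star (\<psi>1 ^ k) * b k) + a 0 + (\<Sum>k=1..N. a k * \<psi>1 ^ k))"
    by (intro tendsto_norm tendsto_add tendsto_sum tendsto_mult tendsto_const f g) auto
  ultimately show ?thesis
    unfolding star_power[symmetric] by (intro LIMSEQ_le) auto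
qed


subsection \<open>The CAR-subalgebra as the fixed-point algebra of the gauge action\<close>

primrec cword :: "bool list \<Rightarrow> 'a" where
  "cword [] = 1"
| "cword (i # \<mu>) = (if i then \<psi>1 else \<psi>2) * cword \<mu>"

inductive homog :: "int \<Rightarrow> 'a \<Rightarrow> bool" where
  homog_word: "homog (int (length \<mu>) - int (length \<nu>)) (cword \<mu> * star (cword \<nu>))"
| homog_zero: "homog k 0"
| homog_add: "homog k x \<Longrightarrow> homog k y \<Longrightarrow> homog k (x + y)"
| homog_scale: "homog k x \<Longrightarrow> homog k (c *\<^sub>C x)"

lemma cword_append: "cword (\<mu> @ \<nu>) = cword \<mu> * cword \<nu>"
  by (induction \<mu>) (simp_all add: mult.assoc)

lemma homog_word_mult:
  "homog (int (length \<mu>) - int (length \<nu>) + (int (length \<alpha>) - int (length \<beta>)))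
    (cword \<mu> * star (cword \<nu>) * (cword \<alpha> * star (cword \<beta>)))"
proof (induction \<nu> arbitrary: \<alpha>)
  case Nil
  show ?case using homog_word[of "\<mu> @ \<alpha>" \<beta>] by (simp add: cword_append algebra_simps)
next
  case (Cons i \<nu>)
  show ?case
  proof (cases \<alpha>)
    case Nil
    show ?thesis
      using homog_word[of \<mu> "\<beta> @ i # \<nu>"] Nil
      by (simp add: cword_append star_mult mult.assoc algebra_simps)
  next
    case (Cons j \<alpha>')
    show ?thesis
    proof (cases "i = j")
      case True
      then show ?thesis
        using Cons.IH[of \<alpha>'] Cons by (auto simp: star_mult algebra_simps cuntz_simps)
    next
      case False
      then show ?thesis
        using homog_zero Cons by (auto simp: star_mult mult.assoc cuntz_simps)
    qed
  qed
qed

lemma homog_mult_word: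
  assumes "homog l y"
  shows "homog (int (length \<mu>) - int (length \<nu>) + l) (cword \<mu> * star (cword \<nu>) * y)"
  using assms
proof (induction rule: homog.induct)
  case (homog_word \<alpha> \<beta>) show ?case by (rule homog_word_mult)
next
  case (homog_scale k x c) then show ?case
    using homog.homog_scale by (simp add: mult_scaleC_right)
qed (auto simp: distrib_left intro: homog.intros)

lemma homog_mult:
  assumes "homog k x" "homog l y"
  shows "homog (k + l) (x * y)"
  using assms
proof (induction rule: homog.induct)
  case (homog_word \<mu> \<nu>) then show ?case by (intro homog_mult_word)
next
  case (homog_scale k x c) then show ?case
    using homog.homog_scale by (simp add: mult_scaleC_left)
qed (auto simp: distrib_right intro: homog.intros)

lemma homog_star: "homog k x \<Longrightarrow> homog (- k) (star x)"
proof (induction rule: homog.induct)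
  case (homog_word \<mu> \<nu>) show ?case
    using homog.homog_word[of \<nu> \<mu>] by (simp add: star_mult)
qed (auto simp: star_add star_scaleC intro: homog.intros)

lemma psi_in_cuntz: "\<psi>1 \<in> cuntz_algebra \<psi>1 \<psi>2" "\<psi>2 \<in> cuntz_algebra \<psi>1 \<psi>2"
  using cstar_gen_superset[of "{\<psi>1, \<psi>2}"] by (simp_all add: cuntz_algebra_def)

lemma word_in_cuntz: "cword \<mu> \<in> cuntz_algebra \<psi>1 \<psi>2"
proof (induction \<mu>)
  case Nil
  have "star \<psi>1 * \<psi>1 \<in> cuntz_algebra \<psi>1 \<psi>2"
    using psi_in_cuntz unfolding cuntz_algebra_def by (intro cstar_genD)
  then show ?case by (simp add: cuntz_simps)
next
  case (Cons i \<mu>)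
  then show ?case
    using psi_in_cuntz unfolding cuntz_algebra_def by (auto intro: cstar_genD)
qed

lemma homog_in_cuntz: "homog k x \<Longrightarrow> x \<in> cuntz_algebra \<psi>1 \<psi>2"
proof (induction rule: homog.induct)
  case (homog_word \<mu> \<nu>)
  show ?case using word_in_cuntz[of \<mu>] word_in_cuntz[of \<nu>]
    unfolding cuntz_algebra_def by (intro cstar_genD)
qed (auto simp: cuntz_algebra_def intro: cstar_genD)

lemma word_in_car:
  assumes "length \<mu> = length \<nu>"
  shows "cword \<mu> * star (cword \<nu>) \<in> car_subalgebra \<psi>1 \<psi>2"
  using assms
proof (induction rule: list_induct2)
  case Nil
  show ?case by (simp add: matrix_units_in_car)
next
  case (Cons i \<mu> j \<nu>)
  let ?Y = "cword \<mu> * star (cword \<nu>)"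
  let ?p = "\<lambda>i. if i then \<psi>1 else \<psi>2"
  have "?p i * star \<psi>1 * delta \<psi>1 ?Y * (\<psi>1 * star (?p j)) \<in> car_subalgebra \<psi>1 \<psi>2"
    using matrix_units_in_car delta_car[OF Cons.IH] carD(4)
    by (cases i; cases j) simp_all
  moreover have "?p i * star \<psi>1 * delta \<psi>1 ?Y * (\<psi>1 * star (?p j))
      = cword (i # \<mu>) * star (cword (j # \<nu>))"
    by (simp add: delta_def mult.assoc star_mult cuntz_simps)
  ultimately show ?case by simp
qed

lemma homog_0_in_car: "homog k x \<Longrightarrow> k = 0 \<Longrightarrow> x \<in> car_subalgebra \<psi>1 \<psi>2"
  by (induction rule: homog.induct) (auto intro: carD word_in_car)

inductive_set graded :: "'a set" where
  graded_homog: "homog k x \<Longrightarrow> x \<in> graded"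
| graded_add: "x \<in> graded \<Longrightarrow> y \<in> graded \<Longrightarrow> x + y \<in> graded"

lemma graded_mult:
  assumes "x \<in> graded" "y \<in> graded"
  shows "x * y \<in> graded"
  using assms
proof (induction rule: graded.induct)
  case (graded_homog k x)
  from graded_homog(2,1) show ?case
    by (induction rule: graded.induct)
      (auto simp: distrib_left intro: graded.intros homog_mult)
qed (auto simp: distrib_right intro: graded.intros)

lemma star_subalgebra_graded: "star_subalgebra graded"
proof -
  have "c *\<^sub>C x \<in> graded" if "x \<in> graded" for c x
    using that by (induction rule: graded.induct)
      (auto simp: scaleC_add_right intro: graded.intros homog_scale)
  moreover have "star x \<in> graded" if "x \<in> graded" for x
    using that by (induction rule: graded.induct)
      (auto simp: star_add intro: graded.intros homog_star)
  ultimately show ?thesis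
    unfolding star_subalgebra_def
    by (auto intro: graded_mult graded_add graded_homog[OF homog_zero])
qed

lemma graded_dense: "cuntz_algebra \<psi>1 \<psi>2 \<subseteq> closure graded"
  unfolding cuntz_algebra_def
proof (rule cstar_gen_subset_closure[OF star_subalgebra_graded])
  show "{\<psi>1, \<psi>2} \<subseteq> graded"
    using graded_homog[OF homog_word[of "[True]" "[]"]] graded_homog[OF homog_word[of "[False]" "[]"]]
    by simp
qed

lemma sum_cis_eq_0:
  fixes k :: int
  assumes "k \<noteq> 0" "\<bar>k\<bar> < int n"
  shows "(\<Sum>j<n. cis (2 * pi * real j / real n) powi k) = 0"
proof -
  have n: "real n > 0" using assms by linarith
  define q where "q = cis (2 * pi * of_int k / real n)"
  have "cis (2 * pi * real j / real n) powi k = q ^ j" for j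
    unfolding q_def by (simp add: cis_power_int Complex.DeMoivre algebra_simps)
  moreover have "q \<noteq> 1"
  proof
    assume "q = 1"
    then have "cos (2 * pi * of_int k / real n) = 1"
      by (metis q_def cis.simps(1) one_complex.sel(1))
    then obtain m :: int where "2 * pi * of_int k / real n = real_of_int m * 2 * pi"
      using cos_one_2pi_int by blast
    then have "real_of_int k = of_int (m * int n)"
      using n by (simp add: field_simps)
    then have "k = m * int n" by linarith
    then show False using assms
      by (metis abs_mult dvd_imp_le_int dvd_triv_right abs_of_nat linorder_not_less)
  qed
  moreover have "q ^ n = 1"
  proof -
    have "q ^ n = cis (2 * pi * of_int k)" using n by (simp add: q_def Complex.DeMoivre)
    then show ?thesis by (simp add: cis_multiple_2pi)
  qed
  ultimately show ?thesis by (simp add: geometric_sum)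
qed

theorem car_subalgebra_eq_gauge_fixed:
  assumes \<tau>: "gauge_action \<psi>1 \<psi>2 \<tau>"
  shows "car_subalgebra \<psi>1 \<psi>2 = gauge_fixed \<psi>1 \<psi>2 \<tau>"
proof
  let ?O = "cuntz_algebra \<psi>1 \<psi>2"
  have O: "star_subalgebra ?O" unfolding cuntz_algebra_def by (rule star_subalgebra_cstar_gen)
  note OD = star_subalgebraD[OF O]
  have hom: "x \<in> ?O \<Longrightarrow> \<tau> z x \<in> ?O"
      "x \<in> ?O \<Longrightarrow> y \<in> ?O \<Longrightarrow> \<tau> z (x + y) = \<tau> z x + \<tau> z y"
      "x \<in> ?O \<Longrightarrow> \<tau> z (c *\<^sub>C x) = c *\<^sub>C \<tau> z x"
      "x \<in> ?O \<Longrightarrow> y \<in> ?O \<Longrightarrow> \<tau> z (x * y) = \<tau> z x * \<tau> z y"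
      "x \<in> ?O \<Longrightarrow> \<tau> z (star x) = star (\<tau> z x)"
      "x \<in> ?O \<Longrightarrow> norm (\<tau> z x) \<le> norm x"
      "\<tau> z \<psi>1 = z *\<^sub>C \<psi>1" "\<tau> z \<psi>2 = z *\<^sub>C \<psi>2"
    if "cmod z = 1" for x y z c
    using \<tau> that unfolding gauge_action_def star_hom_on_def by blast+
  have \<psi>: "\<psi>1 \<in> ?O" "\<psi>2 \<in> ?O" "1 \<in> ?O"
    using word_in_cuntz[of "[True]"] word_in_cuntz[of "[False]"] word_in_cuntz[of "[]"] by simp_all
  have diff: "\<tau> z (x - y) = \<tau> z x - \<tau> z y" if "cmod z = 1" "x \<in> ?O" "y \<in> ?O" for x y z
    using hom(2)[OF that(1,2) OD(3)[OF that(3)], of "-1"] hom(3)[OF that(1,3), of "-1"]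
    by (simp add: scaleC_minus1)
  have one: "\<tau> z 1 = 1" if z: "cmod z = 1" for z
  proof -
    have "\<tau> z (star \<psi>1 * \<psi>1) = star (z *\<^sub>C \<psi>1) * (z *\<^sub>C \<psi>1)"
      using hom[OF z] \<psi> OD(5) by metis
    also have "\<dots> = (cnj z * z) *\<^sub>C 1"
      by (simp add: star_scaleC mult_scaleC_left mult_scaleC_right scaleC_scaleC cuntz_simps mult.commute)
    also have "cnj z * z = 1"
      using complex_norm_square[of z] z by (simp add: mult.commute)
    finally show ?thesis by (simp add: cuntz_simps)
  qed
  have word: "\<tau> z (cword \<mu>) = z ^ length \<mu> *\<^sub>C cword \<mu>" if z: "cmod z = 1" for z \<mu>
  proof (induction \<mu>)
    case Nil show ?case using one[OF z] by simp
  next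
    case (Cons i \<mu>)
    have "\<tau> z (cword (i # \<mu>)) = \<tau> z (if i then \<psi>1 else \<psi>2) * \<tau> z (cword \<mu>)"
      using hom(4)[OF z] \<psi> word_in_cuntz by simp
    also have "\<tau> z (if i then \<psi>1 else \<psi>2) = z *\<^sub>C (if i then \<psi>1 else \<psi>2)"
      using hom(7,8)[OF z] \<psi> by auto
    finally show ?case
      by (simp add: Cons mult_scaleC_left mult_scaleC_right scaleC_scaleC mult.commute[of z])
  qed
  have homog: "\<tau> z x = (z powi k) *\<^sub>C x" if "homog k x" and z: "cmod z = 1" for z k x
    using that(1)
  proof (induction rule: homog.induct)
    case (homog_word \<mu> \<nu>)
    have z0: "z \<noteq> 0" using z by auto
    have "cnj z * z = 1" using complex_norm_square[of z] z by (simp add: mult.commute)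
    then have cz: "cnj z = inverse z" using z0 by (simp add: field_simps)
    have "\<tau> z (cword \<mu> * star (cword \<nu>)) = \<tau> z (cword \<mu>) * star (\<tau> z (cword \<nu>))"
      using hom(4)[OF z] hom(5)[OF z] word_in_cuntz OD(5) by metis
    also have "\<dots> = (z ^ length \<mu> * cnj z ^ length \<nu>) *\<^sub>C (cword \<mu> * star (cword \<nu>))"
      by (simp add: word[OF z] star_scaleC mult_scaleC_left mult_scaleC_right scaleC_scaleC mult.commute)
    also have "z ^ length \<mu> * cnj z ^ length \<nu> = z powi (int (length \<mu>) - int (length \<nu>))"
      using z0 by (simp add: cz power_int_diff power_inverse divide_inverse)
    finally show ?case .
  next
    case (homog_zero k)
    show ?case using hom(3)[OF z OD(1), of 0] by simp
  next
    case (homog_add k x y)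
    then show ?case using hom(2)[OF z] homog_in_cuntz by (metis scaleC_add_right)
  next
    case (homog_scale k x c)
    then show ?case using hom(3)[OF z] homog_in_cuntz by (metis scaleC_scaleC mult.commute)
  qed
  show "car_subalgebra \<psi>1 \<psi>2 \<subseteq> gauge_fixed \<psi>1 \<psi>2 \<tau>"
    unfolding car_subalgebra_def
  proof (rule cstar_gen_minimal)
    show "star_subalgebra (gauge_fixed \<psi>1 \<psi>2 \<tau>)"
      unfolding star_subalgebra_def gauge_fixed_def
    proof (safe, goal_cases)
      case 1 show ?case by (rule OD)
    next
      case (2 z) show ?case using hom(3)[OF 2 OD(1), of 0] by simp
    qed (simp_all add: OD hom)
    show "closed (gauge_fixed \<psi>1 \<psi>2 \<tau>)"
      unfolding closed_sequential_limits
    proof safe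
      fix f l assume f: "\<forall>n. f n \<in> gauge_fixed \<psi>1 \<psi>2 \<tau>" "f \<longlonglongrightarrow> l"
      have l: "l \<in> ?O"
        using f closed_cstar_gen[of "{\<psi>1, \<psi>2}"]
        unfolding closed_sequential_limits gauge_fixed_def cuntz_algebra_def by blast
      have "\<tau> z l = l" if z: "cmod z = 1" for z
      proof -
        have "norm (\<tau> z l - f n) \<le> norm (l - f n)" for n
        proof -
          have "f n \<in> ?O" "\<tau> z (f n) = f n" using f(1) z by (auto simp: gauge_fixed_def)
          then have "norm (\<tau> z l - f n) = norm (\<tau> z (l - f n))"
            using diff[OF z l, of "f n"] by simp
          also have "\<dots> \<le> norm (l - f n)"
            using hom(6)[OF z] l \<open>f n \<in> ?O\<close> OD(6) by blast
          finally show ?thesis .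
        qed
        moreover have "(\<lambda>n. norm (l - f n)) \<longlonglongrightarrow> norm (l - l)"
          by (intro tendsto_intros f)
        moreover have "(\<lambda>n. norm (\<tau> z l - f n)) \<longlonglongrightarrow> norm (\<tau> z l - l)"
          by (intro tendsto_intros f)
        ultimately have "norm (\<tau> z l - l) \<le> norm (l - l)"
          by (intro LIMSEQ_le) auto
        then show ?thesis by simp
      qed
      then show "l \<in> gauge_fixed \<psi>1 \<psi>2 \<tau>" using l by (simp add: gauge_fixed_def)
    qed
    have "homog 0 (car_generator \<psi>1 \<psi>2 (Suc n))" for n
    proof (induction n)
      case 0
      show ?case using homog_word[of "[True]" "[False]"]
        by (simp add: car_generator_def rfs_seed_def)
    next
      case (Suc n)
      let ?x = "car_generator \<psi>1 \<psi>2 (Suc n)"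
      have h: "homog 1 \<psi>1" "homog 1 \<psi>2" "homog (-1) (star \<psi>1)" "homog (-1) (star \<psi>2)"
        using homog_word[of "[True]" "[]"] homog_word[of "[False]" "[]"]
          homog_word[of "[]" "[True]"] homog_word[of "[]" "[False]"] by simp_all
      have "homog 0 (\<psi>1 * ?x * star \<psi>1)" "homog 0 (\<psi>2 * ?x * star \<psi>2)"
        using homog_mult[OF homog_mult[OF h(1) Suc] h(3)] homog_mult[OF homog_mult[OF h(2) Suc] h(4)]
        by simp_all
      then have "homog 0 (\<psi>1 * ?x * star \<psi>1 + (-1) *\<^sub>C (\<psi>2 * ?x * star \<psi>2))"
        by (intro homog_add homog_scale)
      then show ?case by (simp add: car_generator_Suc rfs_zeta_def scaleC_minus1)
    qed
    then have "car_generator \<psi>1 \<psi>2 (Suc n) \<in> gauge_fixed \<psi>1 \<psi>2 \<tau>" for n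
      using homog homog_in_cuntz by (fastforce simp: gauge_fixed_def)
    then show "{car_generator \<psi>1 \<psi>2 n |n. n \<ge> 1} \<subseteq> gauge_fixed \<psi>1 \<psi>2 \<tau>"
      by (auto dest!: Suc_le_D simp: One_nat_def)
  qed
  show "gauge_fixed \<psi>1 \<psi>2 \<tau> \<subseteq> car_subalgebra \<psi>1 \<psi>2"
  proof
    fix x assume x: "x \<in> gauge_fixed \<psi>1 \<psi>2 \<tau>"
    then have xO: "x \<in> ?O" by (simp add: gauge_fixed_def)
    define E where "E n y = (\<Sum>j<n. \<tau> (cis (2 * pi * real j / real n)) y)" for n :: nat and y
    have graded: "y \<in> ?O \<and> (\<exists>y0 N. y0 \<in> car_subalgebra \<psi>1 \<psi>2 \<and> (\<forall>n>N. E n y = real n *\<^sub>R y0))"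
      if "y \<in> graded" for y
      using that
    proof (induction rule: graded.induct)
      case (graded_homog k y)
      note y = homog_in_cuntz[OF graded_homog]
      have E: "E n y = (\<Sum>j<n. cis (2 * pi * real j / real n) powi k) *\<^sub>C y" for n
        by (simp add: E_def homog[OF graded_homog] scaleC_sum_left)
      show ?case
      proof (cases "k = 0")
        case True
        then have "E n y = real n *\<^sub>R y" for n by (simp add: E scaleR_scaleC)
        then show ?thesis using y homog_0_in_car[OF graded_homog True] by blast
      next
        case False
        have "E n y = real n *\<^sub>R 0" if "n > nat \<bar>k\<bar>" for n
          using that sum_cis_eq_0[OF False, of n] by (simp add: E)
        then show ?thesis using y carD(1) by blast
      qed
    next
      case (graded_add y y')
      then obtain a N a' N' where
        "a \<in> car_subalgebra \<psi>1 \<psi>2" "\<And>n. n > N \<Longrightarrow> E n y = real n *\<^sub>R a"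
        "a' \<in> car_subalgebra \<psi>1 \<psi>2" "\<And>n. n > N' \<Longrightarrow> E n y' = real n *\<^sub>R a'" by blast
      moreover have "E n (y + y') = E n y + E n y'" for n
        using graded_add hom(2) by (simp add: E_def sum.distrib)
      ultimately have "\<forall>n > max N N'. E n (y + y') = real n *\<^sub>R (a + a')" "a + a' \<in> car_subalgebra \<psi>1 \<psi>2"
        by (auto simp: scaleR_add_right intro: carD)
      then show ?case using graded_add OD(2) by blast
    qed
    have "x \<in> closure (car_subalgebra \<psi>1 \<psi>2)"
      unfolding closure_approachable
    proof safe
      fix e :: real assume "e > 0"
      then obtain y where y: "y \<in> graded" "dist y x < e"
        using graded_dense xO by (auto simp: closure_approachable subset_iff)
      then obtain y0 N where y0: "y0 \<in> car_subalgebra \<psi>1 \<psi>2" "\<And>n. n > N \<Longrightarrow> E n y = real n *\<^sub>R y0"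
        and yO: "y \<in> ?O" using graded by blast
      define n where "n = Suc N"
      have "real n *\<^sub>R (y0 - x) = E n y - (\<Sum>j<n. x)"
        using y0(2)[of n] by (simp add: n_def scaleR_diff_right sum_constant_scaleR del: sum_constant)
      also have "\<dots> = (\<Sum>j<n. \<tau> (cis (2 * pi * real j / real n)) y - x)"
        by (simp only: E_def sum_subtractf)
      also have "\<dots> = (\<Sum>j<n. \<tau> (cis (2 * pi * real j / real n)) (y - x))"
        using x diff yO xO by (intro sum.cong) (auto simp: gauge_fixed_def)
      also have "norm \<dots> \<le> (\<Sum>j<n. norm (y - x))"
        using hom(6) OD(6)[OF yO xO] by (intro sum_norm_le) auto
      finally have "real n * norm (y0 - x) \<le> real n * norm (y - x)" by simp
      then have "norm (y0 - x) \<le> norm (y - x)" by (simp add: n_def)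
      then show "\<exists>a\<in>car_subalgebra \<psi>1 \<psi>2. dist a x < e"
        using y0(1) y(2) by (auto simp: dist_norm intro!: bexI[of _ y0])
    qed
    then show "x \<in> car_subalgebra \<psi>1 \<psi>2"
      by (simp add: car_subalgebra_def closed_cstar_gen)
  qed
qed

end

end

theory Submission
  imports Defs
begin

text \<open>
  The matrix unit \<open>\<psi>2 * star \<psi>1\<close> lies in the CAR-subalgebra, so the crossed product contains
  \<open>\<psi>2 = (\<psi>2 * star \<psi>1) * \<psi>1\<close>.
\<close>

text \<open>The seed and \<open>rfs_zeta\<close> use only products, adjoints and differences of
  \<psi>1 and \<psi>2, so no CAR generator leaves the algebra. Needed for the inclusion of the
  crossed product in the Cuntz algebra.\<close>

lemma car_subalgebra_subset_cuntz_algebra: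
  "car_subalgebra \<psi>1 \<psi>2 \<subseteq> cuntz_algebra \<psi>1 \<psi>2"
  unfolding car_subalgebra_def
proof (rule cstar_gen_minimal)
  have O: "star_subalgebra (cuntz_algebra \<psi>1 \<psi>2)" "closed (cuntz_algebra \<psi>1 \<psi>2)"
    unfolding cuntz_algebra_def by (rule star_subalgebra_cstar_gen closed_cstar_gen)+
  then show "star_subalgebra (cuntz_algebra \<psi>1 \<psi>2)" "closed (cuntz_algebra \<psi>1 \<psi>2)" .
  have \<psi>: "\<psi>1 \<in> cuntz_algebra \<psi>1 \<psi>2" "\<psi>2 \<in> cuntz_algebra \<psi>1 \<psi>2"
    using cstar_gen_superset[of "{\<psi>1, \<psi>2}"] by (auto simp: cuntz_algebra_def)
  \<comment> \<open>Here \<open>m\<close> stands for the exponent \<open>n - 1\<close> in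
    \<open>car_generator\<close>, so the induction starts at the seed.\<close>
  have "(rfs_zeta \<psi>1 \<psi>2 ^^ m) (rfs_seed \<psi>1 \<psi>2) \<in> cuntz_algebra \<psi>1 \<psi>2" for m
    by (induction m)
      (simp_all add: rfs_zeta_def rfs_seed_def \<psi> star_subalgebraD(4-6)[OF O(1)])
  then show "{car_generator \<psi>1 \<psi>2 n |n. n \<ge> 1} \<subseteq> cuntz_algebra \<psi>1 \<psi>2"
    by (auto simp: car_generator_def)
qed

theorem proposition3p5:
  fixes \<psi>1 \<psi>2 :: "'a::cstar_algebra"
  assumes "cuntz_isometries \<psi>1 \<psi>2"
  shows "crossed_product (car_subalgebra \<psi>1 \<psi>2) \<psi>1 = cuntz_algebra \<psi>1 \<psi>2"
proof
  show "crossed_product (car_subalgebra \<psi>1 \<psi>2) \<psi>1 \<subseteq> cuntz_algebra \<psi>1 \<psi>2"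
    using car_subalgebra_subset_cuntz_algebra[of \<psi>1 \<psi>2] cstar_gen_superset[of "{\<psi>1, \<psi>2}"]
    unfolding crossed_product_def cuntz_algebra_def
    by (intro cstar_gen_minimal star_subalgebra_cstar_gen closed_cstar_gen) auto
next
  let ?B = "cstar_gen (insert \<psi>1 (car_subalgebra \<psi>1 \<psi>2))"
  \<comment> \<open>This matrix unit is the adjoint of the seed, which is the CAR generator of index
    1.\<close>
  have \<psi>1: "\<psi>1 \<in> ?B" and unit: "\<psi>2 * star \<psi>1 \<in> ?B"
    using cstar_gen_superset matrix_units_in_car(2)[OF assms] by blast+
  have "\<psi>2 \<in> ?B"
    \<comment> \<open>After reassociation, \<open>star \<psi>1 * \<psi>1 = 1\<close> leaves
      \<open>\<psi>2\<close>.\<close>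
    using cstar_genD(4)[OF unit \<psi>1] by (simp add: mult.assoc cuntz_relations[OF assms])
  with \<psi>1 show "cuntz_algebra \<psi>1 \<psi>2 \<subseteq> crossed_product (car_subalgebra \<psi>1 \<psi>2) \<psi>1"
    unfolding crossed_product_def cuntz_algebra_def
    by (intro cstar_gen_minimal star_subalgebra_cstar_gen closed_cstar_gen) auto
qed

end
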